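(* Let $\mathbf{x}\in(\Sigma_{n,2d}^* )^\circ$ and $\mathbf{s}\in\Sigma_{n,2d}^\circ$. Define the vector $\mathbf{w}=H(\mathbf{x})^{-1}\mathbf{s}$ and the matrix $\mathbf{S}=\Lambda(\mathbf{x})^{-1}\Lambda(\mathbf{w})\Lambda(\mathbf{x})^{-1}$. Then $\Lambda^*(\mathbf{S})=\mathbf{s}$. Furthermore, if $\big\|H(\mathbf{x})^{-1/2}(\mathbf{s}+\delta g(\mathbf{x}))\big\|<\delta$ for some $\delta>0$, then $\mathbf{S}$ is positive definite.
   Context: $\mathcal{V}_{n,r}$ is the space of real $n$-variate polynomials of total degree at most $r$; $L=\dim\mathcal{V}_{n,d}$, $U=\dim\mathcal{V}_{n,2d}$; $\mathbb{S}^L$ is the space of real symmetric $L\times L$ matrices with the Frobenius inner product $\bullet$. Fix ordered bases $\mathbf{p}=(p_1,\ldots,p_L)$ of $\mathcal{V}_{n,d}$ and $\mathbf{q}=(q_1,\ldots,q_U)$ of $\mathcal{V}_{n,2d}$. $\Sigma_{n,2d}\subset\mathbb{R}^U$ is the cone of coefficient vectors (in the basis $\mathbf{q}$) of polynomials in $\mathcal{V}_{n,2d}$ that are finite sums of squares of polynomials in $\mathcal{V}_{n,d}$; $\Sigma_{n,2d}^*=\{\mathbf{x}\in\mathbb{R}^U:\mathbf{s}^{\mathrm T}\mathbf{x}\ge0\ \forall\,\mathbf{s}\in\Sigma_{n,2d}\}$ is its dual cone; $\mathcal{C}^\circ$ denotes the interior of a set $\mathcal{C}$. $\Lambda:\mathbb{R}^U\to\mathbb{S}^L$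 is the unique linear map with $\Lambda(\mathbf{q})=\mathbf{p}\mathbf{p}^{\mathrm T}$, i.e. $\Lambda(\mathbf{x})=\sum_u x_u\mathbf{E}_u$ where $p_ip_j=\sum_u(\mathbf{E}_u)_{ij}q_u$ as polynomials for all $i,j$; its adjoint is $\Lambda^*(\mathbf{S})=(\mathbf{E}_u\bullet\mathbf{S})_{u=1,\ldots,U}$. It is known that $\Sigma_{n,2d}^*=\{\mathbf{x}:\Lambda(\mathbf{x})\succeq0\}$ and $\Sigma_{n,2d}=\{\Lambda^*(\mathbf{S}):\mathbf{S}\succeq0\}$. $F(\mathbf{x})=-\ln(\det(\Lambda(\mathbf{x})))$ on $(\Sigma_{n,2d}^* )^\circ$, with gradient $g(\mathbf{x})=\nabla F(\mathbf{x})$ and Hessian $H(\mathbf{x})=\nabla^2F(\mathbf{x})$. $\|\cdot\|$ is the Euclidean norm. *)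

theory Defs
  imports "HOL-Analysis.Analysis" "HOL-Analysis.Finite_Function_Topology"
begin

text \<open>
  A monomial is a finitely supported exponent vector and a polynomial is a finitely supported
  map from monomials to coefficients; the ring structure on this type is convolution
  (\<^theory>\<open>HOL-Library.Poly_Mapping\<close>), its real vector space structure is the coefficientwise one
  of \<^theory>\<open>HOL-Analysis.Finite_Function_Topology\<close>.
  There are countably many variables; \<open>n\<close>-variate polynomials use only those with index
  less than \<open>n\<close>.
\<close>

type_synonym monomial = "(nat, nat) poly_mapping"
type_synonym real_mpoly = "(monomial, real) poly_mapping"

definition total_deg :: "monomial \<Rightarrow> nat" where
  "total_deg m = (\<Sum>k\<in>Poly_Mapping.keys m. Poly_Mapping.lookup m k)"

definition polys :: "nat \<Rightarrow> nat \<Rightarrow> real_mpoly set" where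
  "polys n r =
     {f. \<forall>m\<in>Poly_Mapping.keys f. Poly_Mapping.keys m \<subseteq> {..<n} \<and> total_deg m \<le> r}"

text \<open>
  Bases are families indexed by a finite type, whose cardinality is then the dimension
  (\<open>CARD('l) = L\<close> for \<open>polys n d\<close> and \<open>CARD('u) = U\<close> for \<open>polys n (2 * d)\<close>).
\<close>

definition basis_family :: "('i::finite \<Rightarrow> real_mpoly) \<Rightarrow> real_mpoly set \<Rightarrow> bool" where
  "basis_family b V \<longleftrightarrow> inj b \<and> independent (range b) \<and> span (range b) = V"

definition sos_polys :: "nat \<Rightarrow> nat \<Rightarrow> real_mpoly set" where
  "sos_polys n d = {\<Sum>k<N. (f k)\<^sup>2 | f (N::nat). \<forall>k<N. f k \<in> polys n d}"

definition sos_cone :: "nat \<Rightarrow> nat \<Rightarrow> ('u::finite \<Rightarrow> real_mpoly) \<Rightarrow> (real^'u) set" where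
  "sos_cone n d q = {s. (\<Sum>u\<in>UNIV. (s $ u) *\<^sub>R q u) \<in> sos_polys n d}"

definition dual_cone :: "'a::real_inner set \<Rightarrow> 'a set" where
  "dual_cone K = {x. \<forall>s\<in>K. 0 \<le> s \<bullet> x}"

text \<open>
  The matrices \<open>E\<^sub>u\<close> with \<open>p\<^sub>i p\<^sub>j = \<Sum>\<^sub>u (E\<^sub>u)\<^sub>i\<^sub>j q\<^sub>u\<close>; \<^const>\<open>representation\<close> returns coordinates in a
  basis.  The lemma \<open>Emat_unique\<close> below shows that this equation characterises them.
\<close>

definition Emat :: "('l::finite \<Rightarrow> real_mpoly) \<Rightarrow> ('u::finite \<Rightarrow> real_mpoly) \<Rightarrow> 'u \<Rightarrow> real^'l^'l" where
  "Emat p q u = (\<chi> i j. representation (range q) (p i * p j) (q u))"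

definition Lam ::
  "('l::finite \<Rightarrow> real_mpoly) \<Rightarrow> ('u::finite \<Rightarrow> real_mpoly) \<Rightarrow> real^'u \<Rightarrow> real^'l^'l" where
  "Lam p q x = (\<Sum>u\<in>UNIV. (x $ u) *\<^sub>R Emat p q u)"

text \<open>The inner product of \<^typ>\<open>real^'l^'l\<close> is the Frobenius inner product.\<close>

definition Lam_adj ::
  "('l::finite \<Rightarrow> real_mpoly) \<Rightarrow> ('u::finite \<Rightarrow> real_mpoly) \<Rightarrow> real^'l^'l \<Rightarrow> real^'u" where
  "Lam_adj p q S = (\<chi> u. Emat p q u \<bullet> S)"

text \<open>
  The barrier is a total function here, but only its values on the interior of the dual cone,
  where the determinant is positive, are meaningful.
\<close>

definition barrier ::
  "('l::finite \<Rightarrow> real_mpoly) \<Rightarrow> ('u::finite \<Rightarrow> real_mpoly) \<Rightarrow> real^'u \<Rightarrow> real" where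
  "barrier p q x = - ln (det (Lam p q x))"

definition gradient :: "('a::real_inner \<Rightarrow> real) \<Rightarrow> 'a \<Rightarrow> 'a" where
  "gradient f x = (THE D. GDERIV f x :> D)"

definition hessian :: "(real^'u \<Rightarrow> real) \<Rightarrow> real^'u \<Rightarrow> real^'u^'u" where
  "hessian f x = jacobian (gradient f) (at x)"

definition pos_semidef :: "real^'n^'n \<Rightarrow> bool" where
  "pos_semidef A \<longleftrightarrow> transpose A = A \<and> (\<forall>v. 0 \<le> v \<bullet> (A *v v))"

definition pos_def :: "real^'n^'n \<Rightarrow> bool" where
  "pos_def A \<longleftrightarrow> transpose A = A \<and> (\<forall>v. v \<noteq> 0 \<longrightarrow> 0 < v \<bullet> (A *v v))"

text \<open>
  The principal square root; every positive semidefinite matrix has exactly one positive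
  semidefinite square root, so the choice is not a real one.
\<close>

definition psd_sqrt :: "real^'n^'n \<Rightarrow> real^'n^'n" where
  "psd_sqrt A = (SOME B. pos_semidef B \<and> B ** B = A)"

lemma total_deg_add: "total_deg (a + b) = total_deg a + total_deg b"
proof -
  let ?K = "Poly_Mapping.keys a \<union> Poly_Mapping.keys b"
  have *: "total_deg m = (\<Sum>k\<in>?K. Poly_Mapping.lookup m k)"
    if "Poly_Mapping.keys m \<subseteq> ?K" for m
    unfolding total_deg_def using that
    by (intro sum.mono_neutral_left) (auto simp: in_keys_iff)
  show ?thesis
    using *[of a] *[of b] *[of "a + b"] keys_add[of a b]
    by (simp add: lookup_add sum.distrib)
qed

lemma polys_mult:
  assumes "f \<in> polys n r" "g \<in> polys n t"
  shows "f * g \<in> polys n (r + t)"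
  unfolding polys_def
proof (intro CollectI ballI)
  fix m assume "m \<in> Poly_Mapping.keys (f * g)"
  then obtain a b where m: "m = a + b"
    and a: "a \<in> Poly_Mapping.keys f" and b: "b \<in> Poly_Mapping.keys g"
    using keys_mult[of f g] by blast
  have "Poly_Mapping.keys a \<subseteq> {..<n} \<and> total_deg a \<le> r"
    "Poly_Mapping.keys b \<subseteq> {..<n} \<and> total_deg b \<le> t"
    using assms a b unfolding polys_def by blast+
  then show "Poly_Mapping.keys m \<subseteq> {..<n} \<and> total_deg m \<le> r + t"
    using keys_add[of a b] by (auto simp: m total_deg_add)
qed

lemma Emat_unique:
  fixes p :: "'l::finite \<Rightarrow> real_mpoly" and q :: "'u::finite \<Rightarrow> real_mpoly"
  assumes p: "basis_family p (polys n d)" and q: "basis_family q (polys n (2 * d))"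
  shows "(\<forall>i j. p i * p j = (\<Sum>u\<in>UNIV. (E u $ i $ j) *\<^sub>R q u)) \<longleftrightarrow> E = Emat p q"
proof -
  have inj: "inj q" and ind: "independent (range q)" and sp: "span (range q) = polys n (2 * d)"
    using q by (auto simp: basis_family_def)
  have "p i * p j \<in> span (range q)" for i j
  proof -
    have "p k \<in> polys n d" for k
      using p span_base[of "p k" "range p"] by (auto simp: basis_family_def)
    then show ?thesis
      using polys_mult[of "p i" n d "p j" d] by (simp add: sp mult_2)
  qed
  then have ex: "p i * p j = (\<Sum>u\<in>UNIV. (Emat p q u $ i $ j) *\<^sub>R q u)" for i j
    using sum_representation_eq[OF ind, of "p i * p j" "range q"] inj
    by (simp add: Emat_def sum.reindex)
  have uniq: "c u = c' u"
    if "(\<Sum>u\<in>UNIV. c u *\<^sub>R q u) = (\<Sum>u\<in>UNIV. c' u *\<^sub>R q u)" for c c' :: "'u \<Rightarrow> real" and u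
  proof -
    have "(\<Sum>v\<in>range q. (c (inv q v) - c' (inv q v)) *\<^sub>R v) = 0"
      using that inj by (simp add: sum.reindex scaleR_diff_left sum_subtractf)
    from independentD[OF ind _ _ this, of "q u"] show ?thesis
      using inj by simp
  qed
  have "E = Emat p q" if E: "\<forall>i j. p i * p j = (\<Sum>u\<in>UNIV. (E u $ i $ j) *\<^sub>R q u)"
  proof -
    have "E u $ i $ j = Emat p q u $ i $ j" for u i j
      by (rule uniq[OF trans[OF sym[OF E[rule_format]] ex]])
    then show ?thesis by (simp add: vec_eq_iff fun_eq_iff)
  qed
  with ex show ?thesis by blast
qed

end

theory Submission
  imports Defs
begin

text \<open>
  Write \<open>M = \<Lambda>(x)\<close> and \<open>M\<^sup>-\<^sup>1 = C\<^sup>2\<close> with \<open>C\<close> symmetric.  By Jacobi's formula \<open>g(x) = -\<Lambda>\<^sup>*(M\<^sup>-\<^sup>1)\<close> and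
  \<open>H(x) w = \<Lambda>\<^sup>*(M\<^sup>-\<^sup>1 \<Lambda>(w) M\<^sup>-\<^sup>1)\<close>; in particular \<open>H(x) x = -g(x)\<close>, and \<open>\<Lambda>\<^sup>*(S) = s\<close> just says \<open>H(x) w = s\<close>.
  Injectivity of \<open>\<Lambda>\<close>, hence invertibility of \<open>H(x)\<close>, comes from the interior of the cone of sums of
  squares being nonempty: every sum of squares is orthogonal to the kernel of \<open>\<Lambda>\<close>.
  With \<open>u = w - \<delta> x\<close> the squared norm in the hypothesis is \<open>u\<^sup>T H(x) u\<close>, the squared Frobenius norm of
  \<open>C \<Lambda>(u) C = C \<Lambda>(w) C - \<delta> I\<close>; if it is below \<open>\<delta>\<^sup>2\<close> then \<open>C \<Lambda>(w) C\<close> is positive definite, and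
  \<open>S = C (C \<Lambda>(w) C) C\<close> is congruent to it.
\<close>

subsection \<open>Spectral theorem and square roots\<close>

lemma inner_matrix_vector_transpose:
  fixes A :: "real^'n^'m"
  shows "x \<bullet> (A *v y) = (transpose A *v x) \<bullet> y"
  by (simp add: dot_lmul_matrix)

lemma symmetric_matrixI:
  fixes A :: "real^'n^'n"
  assumes "\<And>x y. x \<bullet> (A *v y) = (A *v x) \<bullet> y"
  shows "transpose A = A"
proof -
  have "(transpose A *v x) \<bullet> y = (A *v x) \<bullet> y" for x y
    using assms[of x y] by (simp only: inner_matrix_vector_transpose)
  then have "transpose A *v x = A *v x" for x
    by (metis vector_eq_rdot)
  then show ?thesis by (metis matrix_eq)
qed

text \<open>A maximiser of the Rayleigh quotient on the unit sphere is an eigenvector.\<close>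

lemma symmetric_matrix_eigenvector:
  fixes A :: "real^'n^'n"
  assumes sym: "transpose A = A" and V: "subspace V" "V \<noteq> {0}"
    and inv: "\<And>v. v \<in> V \<Longrightarrow> A *v v \<in> V"
  obtains e l where "e \<in> V" "norm e = 1" "A *v e = l *\<^sub>R e"
proof -
  let ?K = "sphere 0 1 \<inter> V"
  have "compact ?K"
    using V(1) by (intro compact_Int_closed closed_subspace) auto
  moreover have "?K \<noteq> {}"
  proof -
    obtain v where "v \<in> V" "v \<noteq> 0" using V subspace_0 by blast
    then have "sgn v \<in> ?K"
      using V(1) by (auto simp: sgn_div_norm subspace_scale)
    then show ?thesis by blast
  qed
  moreover have "continuous_on ?K (\<lambda>v. v \<bullet> (A *v v))"
    by (intro continuous_intros linear_continuous_on matrix_vector_mul_bounded_linear)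
  ultimately obtain e where e: "e \<in> ?K" and max: "\<And>v. v \<in> ?K \<Longrightarrow> v \<bullet> (A *v v) \<le> e \<bullet> (A *v e)"
    using continuous_attains_sup[of ?K "\<lambda>v. v \<bullet> (A *v v)"] by blast
  define l where "l = e \<bullet> (A *v e)"
  have eV: "e \<in> V" and ne: "e \<bullet> e = 1" using e by (auto simp: dot_square_norm)
  have le: "v \<bullet> (A *v v) \<le> l * (v \<bullet> v)" if "v \<in> V" for v
  proof (cases "v = 0")
    case False
    then have "sgn v \<in> ?K"
      using V(1) that by (auto simp: sgn_div_norm subspace_scale)
    from max[OF this] have "(v \<bullet> (A *v v)) / (norm v)\<^sup>2 \<le> l"
      by (simp add: sgn_div_norm matrix_vector_mult_scaleR l_def power2_eq_square divide_inverse mult_ac)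
    then show ?thesis using False by (simp add: divide_le_eq dot_square_norm)
  qed simp
  have sy: "x \<bullet> (A *v y) = y \<bullet> (A *v x)" for x y
    by (metis inner_matrix_vector_transpose sym inner_commute)
  \<comment> \<open>Moving from \<open>e\<close> to \<open>e + t *\<^sub>R u\<close> keeps the
    Rayleigh bound \<open>le\<close>; its zeroth-order terms cancel, and the term linear in
    \<open>t\<close> must then vanish.\<close>
  have orth: "u \<bullet> (A *v e - l *\<^sub>R e) = 0" if u: "u \<in> V" for u
  proof -
    define a where "a = u \<bullet> (A *v e - l *\<^sub>R e)"
    define b where "b = l * (u \<bullet> u) - u \<bullet> (A *v u)"
    have "2 * t * a \<le> t\<^sup>2 * b" for t
    proof -
      have "e + t *\<^sub>R u \<in> V" using eV u V(1) by (simp add: subspace_add subspace_scale)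
      from le[OF this] show ?thesis
        by (simp add: a_def b_def algebra_simps inner_simps ne l_def[symmetric] sy[of e u]
              inner_commute[of e u] power2_eq_square)
    qed
    \<comment> \<open>For this \<open>t\<close> the linear term dominates the quadratic one unless
      \<open>a = 0\<close>; the summand 1 keeps the denominator positive.\<close>
    note this[of "a / (\<bar>b\<bar> + 1)"]
    then have "2 * a\<^sup>2 / (\<bar>b\<bar> + 1) \<le> a\<^sup>2 * b / (\<bar>b\<bar> + 1)\<^sup>2"
      by (simp add: power2_eq_square)
    then have "2 * a\<^sup>2 * (\<bar>b\<bar> + 1) \<le> a\<^sup>2 * b"
      by (simp add: divide_simps power2_eq_square split: if_splits)
    moreover have "a\<^sup>2 * b \<le> a\<^sup>2 * (\<bar>b\<bar> + 1)"
      by (intro mult_left_mono) auto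
    ultimately have "a\<^sup>2 * (\<bar>b\<bar> + 1) \<le> 0" by linarith
    moreover have "0 < \<bar>b\<bar> + 1" by linarith
    ultimately have "a\<^sup>2 \<le> 0" by (meson mult_pos_pos not_less)
    then show ?thesis by (simp add: a_def)
  qed
  have "A *v e - l *\<^sub>R e \<in> V"
    using eV V(1) inv by (simp add: subspace_diff subspace_scale)
  from orth[OF this] have "A *v e = l *\<^sub>R e" by simp
  with that eV e show ?thesis by auto
qed

text \<open>Induction on the dimension: split off a unit eigenvector \<open>e\<close> and continue
  in its orthogonal complement \<open>W\<close> inside \<open>V\<close>. Symmetry keeps
  \<open>W\<close> invariant, since \<open>e \<bullet> (A *v v) = (A *v e) \<bullet> v = l * (e
  \<bullet> v) = 0\<close> there.\<close>

lemma symmetric_matrix_eigenbasis_subspace: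
  fixes A :: "real^'n^'n"
  assumes sym: "transpose A = A"
  shows "subspace V \<Longrightarrow> (\<And>v. v \<in> V \<Longrightarrow> A *v v \<in> V) \<Longrightarrow>
    \<exists>B. finite B \<and> span B = V \<and> pairwise orthogonal B \<and> (\<forall>b\<in>B. norm b = 1 \<and> (\<exists>l. A *v b = l *\<^sub>R b))"
proof (induction "dim V" arbitrary: V rule: less_induct)
  case less
  show ?case
  proof (cases "V = {0}")
    case True
    then show ?thesis by (intro exI[of _ "{}"]) auto
  next
    case False
    then obtain e l where eV: "e \<in> V" and ne: "norm e = 1" and ee: "A *v e = l *\<^sub>R e"
      using symmetric_matrix_eigenvector[OF sym less.prems(1)] less.prems(2) by metis
    define W where "W = V \<inter> {v. e \<bullet> v = 0}"
    have W: "subspace W"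
      unfolding W_def by (intro subspace_inter less.prems subspace_hyperplane)
    have "e \<notin> W" using ne by (auto simp: W_def)
    then have "W \<subset> V" using eV by (auto simp only: W_def)
    then have "dim W < dim V"
      using W less.prems(1) by (metis dim_psubset span_eq_iff)
    moreover have "A *v v \<in> W" if "v \<in> W" for v
      using that less.prems(2)[of v] inner_matrix_vector_transpose[of e A v]
      by (auto simp: W_def sym ee)
    ultimately obtain B where B: "finite B" "span B = W" "pairwise orthogonal B"
      "\<forall>b\<in>B. norm b = 1 \<and> (\<exists>l. A *v b = l *\<^sub>R b)"
      using less.hyps W by metis
    have "B \<subseteq> W" using B(2) span_superset by blast
    have "span (insert e B) = V"
    proof
      show "span (insert e B) \<subseteq> V"
        using \<open>B \<subseteq> W\<close> eV less.prems(1) by (intro span_minimal) (auto simp: W_def)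
      show "V \<subseteq> span (insert e B)"
      proof
        fix v assume "v \<in> V"
        have "v - (e \<bullet> v) *\<^sub>R e \<in> W"
          using \<open>v \<in> V\<close> eV less.prems(1) ne
          by (simp add: W_def subspace_diff subspace_scale inner_diff_right dot_square_norm)
        then show "v \<in> span (insert e B)"
          unfolding span_insert by (auto simp: B(2))
      qed
    qed
    moreover have "pairwise orthogonal (insert e B)"
      using B(3) \<open>B \<subseteq> W\<close> by (auto simp: pairwise_insert W_def orthogonal_def inner_commute)
    ultimately show ?thesis
      using B ne ee by (intro exI[of _ "insert e B"]) auto
  qed
qed

text \<open>The root \<open>r\<close> scales each vector \<open>b\<close> of an orthonormal
  eigenbasis by the square root of its eigenvalue, which is nonnegative. Its square agrees with
  \<open>A\<close> on the spanning set \<open>B\<close>, hence everywhere.\<close>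

lemma pos_semidef_sqrt_exists:
  fixes A :: "real^'n^'n"
  assumes "pos_semidef A"
  shows "\<exists>R. pos_semidef R \<and> R ** R = A"
proof -
  have sym: "transpose A = A" and psd: "\<And>v. 0 \<le> v \<bullet> (A *v v)"
    using assms by (auto simp: pos_semidef_def)
  obtain B where B: "finite B" "span B = UNIV" "pairwise orthogonal B"
    and nB: "\<And>b. b \<in> B \<Longrightarrow> norm b = 1" and "\<forall>b\<in>B. \<exists>l. A *v b = l *\<^sub>R b"
    using symmetric_matrix_eigenbasis_subspace[OF sym, of UNIV] by auto
  then obtain l where l: "\<And>b. b \<in> B \<Longrightarrow> A *v b = l b *\<^sub>R b" by metis
  have l0: "0 \<le> l b" if "b \<in> B" for b
    using psd[of b] nB[OF that] by (simp add: l[OF that] dot_square_norm)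
  define r where "r v = (\<Sum>b\<in>B. (sqrt (l b) * (b \<bullet> v)) *\<^sub>R b)" for v
  have lin: "linear r"
    unfolding r_def by (auto intro!: linearI simp: inner_add_right algebra_simps sum.distrib scaleR_sum_right)
  have rb: "r b = sqrt (l b) *\<^sub>R b" if "b \<in> B" for b
  proof -
    have "r b = (\<Sum>c\<in>B. if c = b then sqrt (l b) *\<^sub>R b else 0)"
      unfolding r_def using B(3) nB that
      by (intro sum.cong) (auto simp: dot_square_norm pairwise_def orthogonal_def)
    then show ?thesis using B(1) that by simp
  qed
  have R: "matrix r *v v = r v" for v
    by (simp add: lin)
  have "matrix r *v (matrix r *v v) = A *v v" for v
  proof (rule linear_eq_on[of "\<lambda>v. matrix r *v (matrix r *v v)" "(*v) A" v B])
    show "linear (\<lambda>v. matrix r *v (matrix r *v v))"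
      by (simp add: matrix_vector_mul_assoc)
  next
    fix b assume "b \<in> B"
    then show "matrix r *v (matrix r *v b) = A *v b"
      using l0 by (simp add: R rb linear_cmul[OF lin] l)
  qed (simp_all add: B)
  then have "matrix r ** matrix r = A"
    by (simp add: matrix_eq matrix_vector_mul_assoc)
  moreover have "pos_semidef (matrix r)"
    unfolding pos_semidef_def
  proof (intro conjI allI symmetric_matrixI)
    fix x y
    show "x \<bullet> (matrix r *v y) = (matrix r *v x) \<bullet> y"
      by (simp add: R r_def inner_sum_left inner_sum_right inner_commute mult_ac)
    show "0 \<le> x \<bullet> (matrix r *v x)"
      using l0 by (auto simp: R r_def inner_sum_right inner_commute mult.assoc intro!: sum_nonneg)
  qed
  ultimately show ?thesis by blast
qed

lemma psd_sqrt:
  assumes "pos_semidef A"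
  shows "pos_semidef (psd_sqrt A)" "psd_sqrt A ** psd_sqrt A = A"
  using someI_ex[OF pos_semidef_sqrt_exists[OF assms]] by (auto simp: psd_sqrt_def)

text \<open>Removes the square root from the norm in the hypothesis of the theorem; the root is
  symmetric, so one factor can be moved across the inner product.\<close>

lemma norm_psd_sqrt_mult:
  assumes "pos_semidef A"
  shows "(norm (psd_sqrt A *v v))\<^sup>2 = v \<bullet> (A *v v)"
  using psd_sqrt[OF assms]
  by (metis inner_matrix_vector_transpose matrix_vector_mul_assoc pos_semidef_def power2_norm_eq_inner)

section \<open>Inverses and determinants of positive definite matrices\<close>

lemma matrix_inv_mult:
  fixes A :: "real^'n^'n"
  assumes "invertible A"
  shows "A ** matrix_inv A = mat 1" "matrix_inv A ** A = mat 1"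
  using someI_ex[OF assms[unfolded invertible_def]] by (auto simp: matrix_inv_def)

lemma matrix_inv_unique:
  fixes A B :: "real^'n^'n"
  assumes "A ** B = mat 1"
  shows "invertible A" "matrix_inv A = B"
proof -
  show i: "invertible A"
    using assms by (simp add: invertible_right_inverse) (blast intro: assms)
  show "matrix_inv A = B"
    by (metis assms matrix_inv_mult(2)[OF i] matrix_mul_assoc matrix_mul_lid matrix_mul_rid)
qed

lemma pos_def_invertible:
  fixes A :: "real^'n^'n"
  assumes "pos_def A"
  shows "invertible A"
proof -
  have "v = 0" if "A *v v = 0" for v
    using assms that by (force simp: pos_def_def)
  then show ?thesis
    by (metis invertible_left_inverse matrix_left_invertible_ker)
qed

lemma pos_def_matrix_inv:
  fixes A :: "real^'n^'n"
  assumes "pos_def A"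
  shows "pos_def (matrix_inv A)"
proof -
  let ?B = "matrix_inv A"
  note inv = matrix_inv_mult[OF pos_def_invertible[OF assms]]
  have A: "transpose A = A" "\<And>v. v \<noteq> 0 \<Longrightarrow> 0 < v \<bullet> (A *v v)"
    using assms by (auto simp: pos_def_def)
  have AB: "A *v (?B *v v) = v" for v
    by (simp add: matrix_vector_mul_assoc inv)
  have "A ** transpose ?B = mat 1"
    by (metis A(1) inv(2) matrix_transpose_mul transpose_mat)
  then have "transpose ?B = ?B" by (metis matrix_inv_unique(2))
  \<comment> \<open>The form of the inverse at \<open>v\<close> is the form of \<open>A\<close> at
    \<open>?B *v v\<close>, because \<open>v = A *v (?B *v v)\<close>.\<close>
  moreover have "0 < v \<bullet> (?B *v v)" if "v \<noteq> 0" for v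
  proof -
    have "?B *v v \<noteq> 0" using AB[of v] that by auto
    from A(2)[OF this] show ?thesis by (simp add: AB inner_commute)
  qed
  ultimately show ?thesis by (simp add: pos_def_def)
qed

lemma pos_def_imp_pos_semidef: "pos_def A \<Longrightarrow> pos_semidef A"
  unfolding pos_def_def pos_semidef_def by (metis inner_zero_left less_eq_real_def)

text \<open>The determinant is the square of the determinant of the symmetric root, and it is
  nonzero by invertibility.\<close>

lemma pos_def_det_pos:
  fixes A :: "real^'n^'n"
  assumes "pos_def A"
  shows "0 < det A"
proof -
  have "psd_sqrt A ** psd_sqrt A = A"
    by (intro psd_sqrt pos_def_imp_pos_semidef assms)
  then have "det A = (det (psd_sqrt A))\<^sup>2"
    by (metis det_mul power2_eq_square)
  moreover have "det A \<noteq> 0"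
    using pos_def_invertible[OF assms] invertible_det_nz by blast
  ultimately show ?thesis by simp
qed

subsection \<open>Derivatives of the determinant and of the matrix inverse\<close>

lemma bounded_bilinear_matrix_mult:
  "bounded_bilinear (\<lambda>(A::real^'n^'m) (B::real^'k^'n). A ** B)"
  unfolding bilinear_conv_bounded_bilinear[symmetric] bilinear_def
  by (auto intro!: linearI simp: vec_eq_iff matrix_matrix_mult_def algebra_simps sum.distrib sum_distrib_left)

interpretation matrix_mult: bounded_bilinear "\<lambda>(A::real^'n^'m) (B::real^'k^'n). A ** B"
  by (rule bounded_bilinear_matrix_mult)

lemma inner_transpose: "transpose (A :: real^'n^'m) \<bullet> transpose B = A \<bullet> B"
  unfolding transpose_def inner_vec_def by simp (rule sum.swap)

lemma inner_matrix_mult_left: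
  fixes A :: "real^'n^'m" and B :: "real^'k^'n" and C :: "real^'k^'m"
  shows "(A ** B) \<bullet> C = A \<bullet> (C ** transpose B)"
proof -
  have "(A ** B) \<bullet> C = (\<Sum>i\<in>UNIV. \<Sum>j\<in>UNIV. \<Sum>k\<in>UNIV. A$i$k * B$k$j * C$i$j)"
    by (simp add: inner_vec_def matrix_matrix_mult_def sum_distrib_right)
  also have "\<dots> = (\<Sum>i\<in>UNIV. \<Sum>k\<in>UNIV. \<Sum>j\<in>UNIV. A$i$k * B$k$j * C$i$j)"
    by (intro sum.cong refl sum.swap)
  also have "\<dots> = A \<bullet> (C ** transpose B)"
    by (simp add: inner_vec_def matrix_matrix_mult_def transpose_def sum_distrib_left mult_ac)
  finally show ?thesis .
qed

lemma inner_matrix_mult_right: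
  fixes A :: "real^'n^'m" and B :: "real^'k^'n" and C :: "real^'k^'m"
  shows "(A ** B) \<bullet> C = B \<bullet> (transpose A ** C)"
  using inner_matrix_mult_left[of "transpose B" "transpose A" "transpose C"]
  by (metis inner_transpose matrix_transpose_mul transpose_transpose)

lemma trace_matrix_mult: "trace (A ** B) = B \<bullet> transpose (A :: real^'n^'n)"
  unfolding trace_def matrix_matrix_mult_def inner_vec_def transpose_def
  by (simp add: mult.commute) (rule sum.swap)

lemma has_derivative_matrix_nth:
  "((\<lambda>A. A $ i $ j) has_derivative (\<lambda>X. X $ i $ j)) (at (A :: real^'n^'m))"
  by (rule bounded_linear_imp_has_derivative)
     (rule bounded_linear_compose[OF bounded_linear_vec_nth bounded_linear_vec_nth])

text \<open>A permutation other than the identity moves two points, so the corresponding product in the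
  Leibniz formula vanishes to second order at the identity matrix.\<close>

lemma has_derivative_det_mat1: "(det has_derivative trace) (at (mat 1 :: real^'n^'n))"
proof -
  let ?P = "{p. p permutes (UNIV::'n set)}"
  let ?D = "\<lambda>X::real^'n^'n. \<Sum>p\<in>?P. of_int (sign p) *
      (\<Sum>i\<in>UNIV. X $ i $ p i * (\<Prod>j\<in>UNIV - {i}. (mat 1 :: real^'n^'n) $ j $ p j))"
  have "(det has_derivative ?D) (at (mat 1))"
    unfolding det_def[abs_def]
    by (intro has_derivative_sum has_derivative_mult_right has_derivative_prod has_derivative_matrix_nth)
  moreover have "?D X = trace X" for X
  proof -
    have "(\<Prod>j\<in>UNIV - {i}. (mat 1 :: real^'n^'n) $ j $ p j) = 0" if "p \<in> ?P" "p \<noteq> id" for p i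
    proof -
      obtain a where a: "p a \<noteq> a" using \<open>p \<noteq> id\<close> by force
      have "p (p a) \<noteq> p a" using a \<open>p \<in> ?P\<close> by (metis mem_Collect_eq permutes_inverses(2))
      with a obtain j where "j \<noteq> i" "p j \<noteq> j" by metis
      then show ?thesis by (auto simp: prod_zero_iff mat_def intro!: bexI[of _ j])
    qed
    then have "(\<Sum>i\<in>UNIV. X $ i $ p i * (\<Prod>j\<in>UNIV - {i}. (mat 1 :: real^'n^'n) $ j $ p j)) = 0"
      if "p \<in> ?P - {id}" for p
      using that by (intro sum.neutral) auto
    then have "?D X = (\<Sum>p\<in>{id}. of_int (sign p) *
      (\<Sum>i\<in>UNIV. X $ i $ p i * (\<Prod>j\<in>UNIV - {i}. (mat 1 :: real^'n^'n) $ j $ p j)))"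
      by (intro sum.mono_neutral_right) (simp_all add: permutes_id)
    then show ?thesis by (simp add: trace_def mat_def)
  qed
  moreover from this have "?D = trace" by blast
  ultimately show ?thesis by simp
qed

text \<open>Reduces to the identity matrix by the chain rule, via
  \<open>det B = det A * det (matrix_inv A ** B)\<close>.\<close>

lemma has_derivative_det:
  fixes A :: "real^'n^'n"
  assumes "invertible A"
  shows "(det has_derivative (\<lambda>X. det A * trace (matrix_inv A ** X))) (at A)"
proof -
  note inv = matrix_inv_mult[OF assms]
  have "(det has_derivative trace) (at (matrix_inv A ** A))"
    by (simp add: inv has_derivative_det_mat1)
  then have "((\<lambda>B. det A * det (matrix_inv A ** B)) has_derivative (\<lambda>X. det A * trace (matrix_inv A ** X))) (at A)"
    by (intro has_derivative_mult_right has_derivative_compose[of "\<lambda>B. matrix_inv A ** B" _ _ _ det]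
        bounded_linear_imp_has_derivative matrix_mult.bounded_linear_right)
  moreover have "det A * det (matrix_inv A ** B) = det B" for B
    by (metis det_mul inv(1) matrix_mul_assoc matrix_mul_lid)
  ultimately show ?thesis by simp
qed

text \<open>Stated through entries so that it also covers the matrices with one column replaced that
  occur in Cramer's rule.\<close>

lemma differentiable_det:
  assumes "\<And>i j. (\<lambda>x. A x $ i $ j) differentiable (at x)"
  shows "(\<lambda>x. det (A x :: real^'n^'n)) differentiable (at x)"
proof -
  obtain D where D: "\<And>i j. ((\<lambda>x. A x $ i $ j) has_derivative D i j) (at x)"
    using assms unfolding differentiable_def by metis
  have "(\<lambda>x. \<Prod>i\<in>UNIV. A x $ i $ p i) differentiable (at x)" for p
    by (rule differentiableI, rule has_derivative_prod) (rule D)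
  then show ?thesis
    unfolding det_def by (intro differentiable_sum differentiable_mult) auto
qed

text \<open>Lets identities that hold only for invertible matrices be differentiated at an
  invertible point.\<close>

lemma open_invertible: "open {A :: real^'n^'n. invertible A}"
proof -
  have "continuous_on UNIV (det :: real^'n^'n \<Rightarrow> real)"
    by (intro continuous_at_imp_continuous_on ballI differentiable_imp_continuous_within
        differentiable_det differentiableI[OF has_derivative_matrix_nth])
  then have "open {A :: real^'n^'n. det A \<noteq> 0}"
    by (intro open_Collect_neq continuous_intros)
  then show ?thesis by (simp add: invertible_det_nz)
qed

text \<open>Cramer's rule for the linear system that column \<open>l\<close> of the inverse solves,
  with column \<open>l\<close> of the identity on the right.\<close>

lemma matrix_inv_nth:
  fixes A :: "real^'n^'n"
  assumes "invertible A"
  shows "matrix_inv A $ k $ l = det (\<chi> i j. if j = k then mat 1 $ i $ l else A $ i $ j) / det A"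
proof -
  have "A *v column l (matrix_inv A) = column l (mat 1)"
    using matrix_inv_mult(1)[OF assms] by (metis matrix_vector_mult_basis matrix_vector_mul_assoc)
  then have "column l (matrix_inv A) $ k = (\<chi> k. det (\<chi> i j. if j = k then column l (mat 1) $ i else A $ i $ j) / det A) $ k"
    using assms by (simp add: cramer invertible_det_nz)
  then show ?thesis by (simp add: column_def cong: if_cong)
qed

text \<open>By Cramer's rule the entries are quotients of determinants. The map reassembled from
  these quotients and the unit matrices is differentiable at \<open>A\<close> and equals
  \<open>matrix_inv\<close> on the open set of invertible matrices.\<close>

lemma differentiable_matrix_inv:
  fixes A :: "real^'n^'n"
  assumes "invertible A"
  shows "matrix_inv differentiable (at A)"
proof -
  define c where "c k l B = det (\<chi> i j. if j = k then mat 1 $ i $ l else B $ i $ j) / det B"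
    for k l :: 'n and B :: "real^'n^'n"
  have nth: "(\<lambda>B. B $ i $ j) differentiable (at A)" for i j :: 'n
    using has_derivative_matrix_nth by (rule differentiableI)
  have "c k l differentiable (at A)" for k l
    unfolding c_def
  proof (intro differentiable_divide differentiable_det)
    show "(\<lambda>B. (\<chi> i j. if j = k then mat 1 $ i $ l else B $ i $ j) $ i $ j) differentiable (at A)" for i j
      by (cases "j = k") (simp_all add: nth)
  qed (use assms nth in \<open>auto simp: invertible_det_nz\<close>)
  then have "(\<lambda>B. \<Sum>k\<in>UNIV. \<Sum>l\<in>UNIV. c k l B *\<^sub>R (axis k (axis l 1) :: real^'n^'n)) differentiable (at A)"
    by (intro differentiable_sum differentiable_scaleR) auto
  then obtain D where
    "((\<lambda>B. \<Sum>k\<in>UNIV. \<Sum>l\<in>UNIV. c k l B *\<^sub>R (axis k (axis l 1) :: real^'n^'n)) has_derivative D) (at A)"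
    by (auto simp: differentiable_def)
  then have "(matrix_inv has_derivative D) (at A)"
  proof (rule has_derivative_transform_within_open[OF _ open_invertible])
    fix B :: "real^'n^'n" assume "B \<in> {A. invertible A}"
    then have "matrix_inv B $ i $ j = c i j B" for i j
      by (simp add: c_def matrix_inv_nth)
    moreover have "(\<Sum>k\<in>UNIV. \<Sum>l\<in>UNIV. c k l B *\<^sub>R axis k (axis l 1)) $ i $ j = c i j B" for i j
    proof -
      have "(\<Sum>k\<in>UNIV. \<Sum>l\<in>UNIV. c k l B *\<^sub>R axis k (axis l 1)) $ i $ j
          = (\<Sum>k\<in>UNIV. \<Sum>l\<in>UNIV. if l = j then (if k = i then c k j B else 0) else 0)"
        unfolding sum_component by (intro sum.cong refl) (auto simp: axis_def)
      then show ?thesis by simp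
    qed
    ultimately show "(\<Sum>k\<in>UNIV. \<Sum>l\<in>UNIV. c k l B *\<^sub>R axis k (axis l 1)) = matrix_inv B"
      by (simp add: vec_eq_iff)
  qed (simp add: assms)
  then show ?thesis by (rule differentiableI)
qed

text \<open>Once some derivative \<open>D\<close> exists, the product rule for
  \<open>B ** matrix_inv B\<close>, which is constant near \<open>A\<close>, gives a linear equation
  that determines \<open>D\<close>.\<close>

lemma has_derivative_matrix_inv:
  fixes A :: "real^'n^'n"
  assumes "invertible A"
  shows "(matrix_inv has_derivative (\<lambda>X. - (matrix_inv A ** X ** matrix_inv A))) (at A)"
proof -
  note inv = matrix_inv_mult[OF assms]
  obtain D where D: "(matrix_inv has_derivative D) (at A)"
    using differentiable_matrix_inv[OF assms] by (auto simp: differentiable_def)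
  have "((\<lambda>B. B ** matrix_inv B) has_derivative (\<lambda>X. A ** D X + X ** matrix_inv A)) (at A)"
    by (rule matrix_mult.FDERIV[OF has_derivative_ident D])
  moreover have "((\<lambda>B. B ** matrix_inv B) has_derivative (\<lambda>X. 0)) (at A)"
    by (rule has_derivative_transform_within_open[OF has_derivative_const[of "mat 1"] open_invertible])
       (auto simp: assms matrix_inv_mult)
  ultimately have "(\<lambda>X. A ** D X + X ** matrix_inv A) = (\<lambda>X. 0)"
    by (rule has_derivative_unique)
  then have "A ** D X + X ** matrix_inv A = 0" for X
    by (rule fun_cong)
  then have "A ** D X = - (X ** matrix_inv A)" for X
    by (simp add: eq_neg_iff_add_eq_0)
  then have "matrix_inv A ** (A ** D X) = - (matrix_inv A ** X ** matrix_inv A)" for X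
    by (simp add: matrix_mult.minus_right matrix_mul_assoc)
  then have "D = (\<lambda>X. - (matrix_inv A ** X ** matrix_inv A))"
    by (simp add: fun_eq_iff matrix_mul_assoc inv)
  with D show ?thesis by simp
qed
text \<open>With \<open>C\<close> the root of \<open>matrix_inv (Lam p q x)\<close>, this turns the
  Hessian form into a Frobenius product of two congruent matrices.\<close>

lemma inner_congruence:
  fixes C X Y :: "real^'n^'n"
  assumes "transpose C = C"
  shows "X \<bullet> ((C ** C) ** Y ** (C ** C)) = (C ** X ** C) \<bullet> (C ** Y ** C)"
  by (simp add: inner_matrix_mult_left[of "C ** X" C] inner_matrix_mult_right[of C X] assms matrix_mul_assoc)

lemma psd_sqrt_matrix_inv:
  assumes "pos_def A"
  shows "transpose (psd_sqrt (matrix_inv A)) = psd_sqrt (matrix_inv A)"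
    "psd_sqrt (matrix_inv A) ** psd_sqrt (matrix_inv A) = matrix_inv A"
  using psd_sqrt[OF pos_def_imp_pos_semidef[OF pos_def_matrix_inv[OF assms]]]
  by (auto simp: pos_semidef_def)

subsection \<open>The operator \<open>\<Lambda>\<close> and the barrier\<close>

text \<open>Links the coefficientwise vector space structure to the convolution ring, so that
  scalars can be pulled out of products.\<close>

lemma scaleR_eq_single_mult:
  fixes f :: "'a::monoid_add \<Rightarrow>\<^sub>0 real"
  shows "c *\<^sub>R f = Poly_Mapping.single 0 c * f"
proof -
  have "finite {i. c * Poly_Mapping.lookup f i \<noteq> 0}"
    by (rule finite_subset[OF _ finite_lookup[of f]]) auto
  then have "c *\<^sub>R f = Poly_Mapping.map ((*) c) f"
    by (intro poly_mapping_eqI)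
       (simp add: scaleR_poly_mapping_def Poly_Mapping.map.rep_eq when_def)
  then show ?thesis by (simp add: mult_map_scale_conv_mult)
qed

lemma poly_mapping_mult_scaleR:
  fixes f g :: "'a::comm_monoid_add \<Rightarrow>\<^sub>0 real"
  shows "(a *\<^sub>R f) * (b *\<^sub>R g) = (a * b) *\<^sub>R (f * g)"
proof -
  have "Poly_Mapping.single 0 (a * b) = Poly_Mapping.single 0 a * Poly_Mapping.single (0::'a) b"
    by (simp add: mult_single)
  then show ?thesis by (simp add: scaleR_eq_single_mult mult_ac)
qed

lemma basis_family_sum_unique:
  assumes "basis_family b V" and "(\<Sum>i\<in>UNIV. c i *\<^sub>R b i) = (\<Sum>i\<in>UNIV. c' i *\<^sub>R b i)"
  shows "c = c'"
proof
  fix i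
  have inj: "inj b" and ind: "independent (range b)"
    using assms(1) by (auto simp: basis_family_def)
  have "(\<Sum>v\<in>range b. (c (inv b v) - c' (inv b v)) *\<^sub>R v) = 0"
    using assms(2) inj by (simp add: sum.reindex scaleR_diff_left sum_subtractf)
  from independentD[OF ind _ _ this, of "b i"] show "c i = c' i"
    using inj by simp
qed

lemma basis_family_sum_exists:
  assumes "basis_family b V" "v \<in> V"
  obtains c where "v = (\<Sum>i\<in>UNIV. c i *\<^sub>R b i)"
proof -
  have "v \<in> span (range b)" using assms by (simp add: basis_family_def)
  then obtain c where "v = (\<Sum>w\<in>range b. c w *\<^sub>R w)"
    by (auto simp: span_finite)
  then have "v = (\<Sum>i\<in>UNIV. c (b i) *\<^sub>R b i)"
    using assms(1) by (simp add: basis_family_def sum.reindex)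
  then show ?thesis by (rule that)
qed

lemma bounded_linear_Lam: "bounded_linear (Lam p q)"
  unfolding linear_conv_bounded_linear[symmetric] Lam_def
  by (auto intro!: linearI simp: scaleR_add_left sum.distrib scaleR_sum_right)

lemmas linear_Lam = bounded_linear.linear[OF bounded_linear_Lam]

lemma inner_Lam_adj: "y \<bullet> Lam_adj p q S = Lam p q y \<bullet> S"
  by (simp add: Lam_adj_def Lam_def inner_vec_def[of y] inner_sum_left)

lemma bounded_linear_Lam_adj: "bounded_linear (Lam_adj p q)"
  unfolding linear_conv_bounded_linear[symmetric] Lam_adj_def
  by (auto intro!: linearI simp: vec_eq_iff inner_add_right)

lemma transpose_Lam: "transpose (Lam p q y) = Lam p q y"
  by (simp add: Lam_def Emat_def transpose_def vec_eq_iff mult.commute)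

text \<open>The Gram matrix of the square of the polynomial with coefficient vector
  \<open>a\<close>; see \<open>square_sum\<close>.\<close>

definition outer :: "real^'n \<Rightarrow> real^'n^'n" where
  "outer a = (\<chi> i j. a $ i * a $ j)"

lemma inner_outer: "A \<bullet> outer a = a \<bullet> (A *v a)"
  by (simp add: outer_def inner_vec_def matrix_vector_mult_def sum_distrib_left mult_ac)

lemma norm_outer: "norm (outer a) = (norm a)\<^sup>2"
proof -
  have "outer a \<bullet> outer a = (a \<bullet> a) * (a \<bullet> a)"
    by (simp add: outer_def inner_vec_def sum_product mult_ac)
  then show ?thesis
    by (simp add: norm_eq_sqrt_inner)
qed

text \<open>Cauchy-Schwarz for the Frobenius product of \<open>A\<close> with the rank-one matrix
  \<open>outer a\<close>.\<close>

lemma abs_quadratic_form_le: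
  fixes A :: "real^'n^'n"
  shows "\<bar>a \<bullet> (A *v a)\<bar> \<le> norm A * (norm a)\<^sup>2"
  using Cauchy_Schwarz_ineq2[of A "outer a"] by (simp add: inner_outer norm_outer)

section \<open>Gradient and Hessian from derivatives; the gradient of the barrier\<close>

lemma gradient_eqI:
  assumes "GDERIV f x :> D"
  shows "gradient f x = D"
  unfolding gradient_def
proof (rule the_equality)
  show "GDERIV f x :> D" by (rule assms)
next
  fix D' assume "GDERIV f x :> D'"
  then have "(\<lambda>h. h \<bullet> D') = (\<lambda>h. h \<bullet> D)"
    using assms unfolding gderiv_def by (rule has_derivative_unique)
  then show "D' = D" by (metis vector_eq_ldot)
qed

lemma hessian_mult_eqI:
  assumes "(gradient f has_derivative D) (at x)"
  shows "hessian f x *v h = D h"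
  using assms frechet_derivative_at[OF assms] has_derivative_linear[OF assms]
  by (simp add: hessian_def jacobian_def)

lemma gradient_barrier:
  assumes "pos_def (Lam p q y)"
  shows "gradient (barrier p q) y = - Lam_adj p q (matrix_inv (Lam p q y))"
proof (rule gradient_eqI, unfold gderiv_def)
  let ?M = "Lam p q y"
  have det: "0 < det ?M" by (rule pos_def_det_pos[OF assms])
  have sym: "transpose (matrix_inv ?M) = matrix_inv ?M"
    using pos_def_matrix_inv[OF assms] by (simp add: pos_def_def)
  have "((\<lambda>y. det (Lam p q y)) has_derivative (\<lambda>h. det ?M * trace (matrix_inv ?M ** Lam p q h))) (at y)"
    by (rule has_derivative_compose[OF bounded_linear_imp_has_derivative[OF bounded_linear_Lam]
          has_derivative_det[OF pos_def_invertible[OF assms]]])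
  \<comment> \<open>The factor \<open>det ?M\<close> from Jacobi's formula cancels against the
    derivative of the logarithm; symmetry of the inverse turns the trace into a Frobenius
    product.\<close>
  from has_derivative_minus[OF has_derivative_ln[OF det this]]
  show "(barrier p q has_derivative (\<lambda>h. h \<bullet> - Lam_adj p q (matrix_inv ?M))) (at y)"
    using det by (simp add: barrier_def[abs_def] trace_matrix_mult sym inner_Lam_adj field_simps)
qed

section \<open>Sums of squares, their dual cone, and the Hessian of the barrier\<close>

locale gram_bases =
  fixes n d :: nat and p :: "'l::finite \<Rightarrow> real_mpoly" and q :: "'u::finite \<Rightarrow> real_mpoly"
  assumes p: "basis_family p (polys n d)" and q: "basis_family q (polys n (2 * d))"
begin

lemma square_sum:
  "(\<Sum>i\<in>UNIV. (a $ i) *\<^sub>R p i)\<^sup>2 = (\<Sum>u\<in>UNIV. (Lam_adj p q (outer a) $ u) *\<^sub>R q u)"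
proof -
  have E: "p i * p j = (\<Sum>u\<in>UNIV. (Emat p q u $ i $ j) *\<^sub>R q u)" for i j
    using Emat_unique[OF p q, of "Emat p q"] by blast
  have "(\<Sum>i\<in>UNIV. (a $ i) *\<^sub>R p i)\<^sup>2
      = (\<Sum>i\<in>UNIV. \<Sum>j\<in>UNIV. \<Sum>u\<in>UNIV. (a $ i * a $ j * Emat p q u $ i $ j) *\<^sub>R q u)"
    by (simp add: power2_eq_square sum_product poly_mapping_mult_scaleR E scaleR_sum_right)
  also have "\<dots> = (\<Sum>i\<in>UNIV. \<Sum>u\<in>UNIV. \<Sum>j\<in>UNIV. (a $ i * a $ j * Emat p q u $ i $ j) *\<^sub>R q u)"
    by (intro sum.cong refl sum.swap)
  also have "\<dots> = (\<Sum>u\<in>UNIV. \<Sum>i\<in>UNIV. \<Sum>j\<in>UNIV. (a $ i * a $ j * Emat p q u $ i $ j) *\<^sub>R q u)"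
    by (rule sum.swap)
  also have "\<dots> = (\<Sum>u\<in>UNIV. (Lam_adj p q (outer a) $ u) *\<^sub>R q u)"
    by (simp add: Lam_adj_def inner_vec_def outer_def scaleR_sum_left mult_ac)
  finally show ?thesis .
qed

lemma Lam_adj_outer_in_sos_cone: "Lam_adj p q (outer a) \<in> sos_cone n d q"
proof -
  have "(\<Sum>i\<in>UNIV. (a $ i) *\<^sub>R p i) \<in> span (range p)"
    by (intro span_sum span_scale span_base) auto
  then have "(\<Sum>i\<in>UNIV. (a $ i) *\<^sub>R p i) \<in> polys n d"
    using p by (simp add: basis_family_def)
  then have "(\<Sum>i\<in>UNIV. (a $ i) *\<^sub>R p i)\<^sup>2 \<in> sos_polys n d"
    unfolding sos_polys_def by (intro CollectI exI[of _ "\<lambda>_. \<Sum>i\<in>UNIV. (a $ i) *\<^sub>R p i"] exI[of _ 1]) simp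
  then show ?thesis by (simp add: sos_cone_def square_sum)
qed

text \<open>A polynomial whose square vanishes is zero, and the family \<open>p\<close> is linearly
  independent.\<close>

lemma Lam_adj_outer_eq_0:
  assumes "Lam_adj p q (outer a) = 0"
  shows "a = 0"
proof -
  have "(\<Sum>i\<in>UNIV. (a $ i) *\<^sub>R p i)\<^sup>2 = 0"
    by (simp add: square_sum assms)
  then have "(\<Sum>i\<in>UNIV. (a $ i) *\<^sub>R p i) = (\<Sum>i\<in>UNIV. 0 *\<^sub>R p i)"
    by simp
  then have "(\<lambda>i. a $ i) = (\<lambda>i. 0)"
    by (rule basis_family_sum_unique[OF p])
  then show ?thesis by (simp add: vec_eq_iff fun_eq_iff)
qed

text \<open>Each square contributes one rank-one Gram matrix, and coordinates in the basis
  \<open>q\<close> are unique.\<close>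

lemma sos_cone_obtain:
  assumes "t \<in> sos_cone n d q"
  obtains N :: nat and a where "t = (\<Sum>k<N. Lam_adj p q (outer (a k)))"
proof -
  obtain N :: nat and f where f: "\<And>k. k < N \<Longrightarrow> f k \<in> polys n d"
    and t: "(\<Sum>u\<in>UNIV. (t $ u) *\<^sub>R q u) = (\<Sum>k<N. (f k)\<^sup>2)"
    using assms by (auto simp: sos_cone_def sos_polys_def)
  have "\<exists>a. f k = (\<Sum>i\<in>UNIV. (a $ i) *\<^sub>R p i)" if k: "k < N" for k
  proof -
    obtain c where "f k = (\<Sum>i\<in>UNIV. c i *\<^sub>R p i)"
      using basis_family_sum_exists[OF p f[OF k]] .
    then show ?thesis by (intro exI[of _ "\<chi> i. c i"]) simp
  qed
  then obtain a where a: "\<And>k. k < N \<Longrightarrow> f k = (\<Sum>i\<in>UNIV. (a k $ i) *\<^sub>R p i)"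
    by metis
  have "(\<Sum>k<N. (f k)\<^sup>2) = (\<Sum>k<N. \<Sum>u\<in>UNIV. (Lam_adj p q (outer (a k)) $ u) *\<^sub>R q u)"
    by (simp add: a square_sum)
  also have "\<dots> = (\<Sum>u\<in>UNIV. ((\<Sum>k<N. Lam_adj p q (outer (a k))) $ u) *\<^sub>R q u)"
    by (subst sum.swap) (simp add: scaleR_sum_left)
  finally have "(\<lambda>u. t $ u) = (\<lambda>u. (\<Sum>k<N. Lam_adj p q (outer (a k))) $ u)"
    using t by (intro basis_family_sum_unique[OF q]) simp
  then have "t = (\<Sum>k<N. Lam_adj p q (outer (a k)))"
    by (simp add: vec_eq_iff fun_eq_iff)
  then show ?thesis by (rule that)
qed

text \<open>An interior point of the dual cone can be moved a little against a nonzero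
  \<open>t\<close> of the cone and stay dual, so its product with \<open>t\<close> is strictly
  positive. For \<open>t = Lam_adj p q (outer a)\<close> that product is the quadratic form at
  \<open>a\<close>.\<close>

lemma Lam_pos_def:
  assumes "x \<in> interior (dual_cone (sos_cone n d q))"
  shows "pos_def (Lam p q x)"
  unfolding pos_def_def
proof (intro conjI allI impI)
  show "transpose (Lam p q x) = Lam p q x" by (rule transpose_Lam)
next
  fix a :: "real^'l" assume "a \<noteq> 0"
  define t where "t = Lam_adj p q (outer a)"
  have "t \<noteq> 0" using Lam_adj_outer_eq_0 \<open>a \<noteq> 0\<close> by (auto simp: t_def)
  obtain e where e: "e > 0" "cball x e \<subseteq> dual_cone (sos_cone n d q)"
    using assms by (auto simp: mem_interior_cball)
  have "x - (e / norm t) *\<^sub>R t \<in> cball x e"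
    using e(1) \<open>t \<noteq> 0\<close> by (simp add: dist_norm)
  then have "0 \<le> t \<bullet> (x - (e / norm t) *\<^sub>R t)"
    using e(2) Lam_adj_outer_in_sos_cone[of a] unfolding dual_cone_def t_def[symmetric] by blast
  then have "e / norm t * (t \<bullet> t) \<le> x \<bullet> t"
    by (simp add: inner_diff_right inner_commute)
  moreover have "0 < e / norm t * (t \<bullet> t)"
    using e(1) \<open>t \<noteq> 0\<close> by simp
  ultimately show "0 < a \<bullet> (Lam p q x *v a)"
    by (simp add: t_def inner_Lam_adj inner_outer)
qed

lemma Lam_eq_0:
  assumes s: "s \<in> interior (sos_cone n d q)" and w: "Lam p q w = 0"
  shows "w = 0"
proof (rule ccontr)
  assume "w \<noteq> 0"
  have orth: "w \<bullet> t = 0" if t: "t \<in> sos_cone n d q" for t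
    by (rule sos_cone_obtain[OF t]) (simp add: inner_sum_right inner_Lam_adj w)
  obtain e where e: "e > 0" "cball s e \<subseteq> sos_cone n d q"
    using s by (auto simp: mem_interior_cball)
  \<comment> \<open>Both points lie in the cone and are thus orthogonal to \<open>w\<close>,
    although they differ by a nonzero multiple of \<open>w\<close>.\<close>
  have "s \<in> cball s e" "s + (e / norm w) *\<^sub>R w \<in> cball s e"
    using e(1) \<open>w \<noteq> 0\<close> by (simp_all add: dist_norm)
  then have "w \<bullet> s = 0" "w \<bullet> (s + (e / norm w) *\<^sub>R w) = 0"
    using e(2) orth by blast+
  then show False
    using \<open>w \<noteq> 0\<close> e(1) by (simp add: inner_add_right)
qed

lemma hessian_barrier_mult:
  assumes "x \<in> interior (dual_cone (sos_cone n d q))"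
  shows "hessian (barrier p q) x *v h =
    Lam_adj p q (matrix_inv (Lam p q x) ** Lam p q h ** matrix_inv (Lam p q x))"
proof (rule hessian_mult_eqI)
  let ?N = "matrix_inv (Lam p q x)"
  have "((\<lambda>y. matrix_inv (Lam p q y)) has_derivative (\<lambda>h. - (?N ** Lam p q h ** ?N))) (at x)"
    by (rule has_derivative_compose[OF bounded_linear_imp_has_derivative[OF bounded_linear_Lam]
          has_derivative_matrix_inv[OF pos_def_invertible[OF Lam_pos_def[OF assms]]]])
  then have "((\<lambda>y. - Lam_adj p q (matrix_inv (Lam p q y))) has_derivative
      (\<lambda>h. - Lam_adj p q (- (?N ** Lam p q h ** ?N)))) (at x)"
    by (intro has_derivative_minus bounded_linear.has_derivative[OF bounded_linear_Lam_adj])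
  \<comment> \<open>The gradient formula holds on the whole open interior, so it may replace the
    gradient under the derivative.\<close>
  then have "(gradient (barrier p q) has_derivative
      (\<lambda>h. - Lam_adj p q (- (?N ** Lam p q h ** ?N)))) (at x)"
    by (rule has_derivative_transform_within_open[OF _ open_interior assms])
       (simp add: gradient_barrier Lam_pos_def)
  then show "(gradient (barrier p q) has_derivative (\<lambda>h. Lam_adj p q (?N ** Lam p q h ** ?N))) (at x)"
    by (simp add: linear_neg[OF bounded_linear.linear[OF bounded_linear_Lam_adj]])
qed

lemma hessian_barrier_pos_def:
  assumes x: "x \<in> interior (dual_cone (sos_cone n d q))" and s: "s \<in> interior (sos_cone n d q)"
  shows "pos_def (hessian (barrier p q) x)"
proof -
  let ?H = "hessian (barrier p q) x" and ?M = "Lam p q x"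
  define C where "C = psd_sqrt (matrix_inv ?M)"
  have C: "transpose C = C" "C ** C = matrix_inv ?M"
    and inv: "?M ** matrix_inv ?M = mat 1" "matrix_inv ?M ** ?M = mat 1"
    using psd_sqrt_matrix_inv[OF Lam_pos_def[OF x]] matrix_inv_mult[OF pos_def_invertible[OF Lam_pos_def[OF x]]]
    by (simp_all add: C_def)
  \<comment> \<open>This representation yields both symmetry and nonnegativity of the Hessian
    form.\<close>
  have H: "v \<bullet> (?H *v w) = (C ** Lam p q v ** C) \<bullet> (C ** Lam p q w ** C)" for v w
    by (simp add: hessian_barrier_mult[OF x] inner_Lam_adj C(2)[symmetric] inner_congruence[OF C(1)])
  show ?thesis
    unfolding pos_def_def
  proof (intro conjI symmetric_matrixI allI impI)
    show "v \<bullet> (?H *v w) = (?H *v v) \<bullet> w" for v w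
      using H[of v w] H[of w v] by (simp add: inner_commute)
    fix w :: "real^'u" assume "w \<noteq> 0"
    then have "Lam p q w \<noteq> 0" using Lam_eq_0[OF s] by blast
    \<comment> \<open>\<open>?M ** C\<close> and \<open>C ** ?M\<close> undo the congruence by
      \<open>C\<close>, so \<open>C ** Lam p q w ** C\<close> can vanish only if
      \<open>Lam p q w\<close> does.\<close>
    moreover have "Lam p q w = ?M ** C ** (C ** Lam p q w ** C) ** (C ** ?M)"
    proof -
      have "Lam p q w = (?M ** matrix_inv ?M) ** Lam p q w ** (matrix_inv ?M ** ?M)"
        by (simp add: inv)
      then show ?thesis by (simp only: C(2)[symmetric] matrix_mul_assoc)
    qed
    ultimately have "C ** Lam p q w ** C \<noteq> 0"
      by (metis matrix_mult.zero_left matrix_mult.zero_right)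
    then show "0 < w \<bullet> (?H *v w)"
      by (simp add: H)
  qed
qed

end

section \<open>The preimage of \<open>s\<close> under the adjoint and its positive
  definiteness\<close>

theorem theorem5p1:
  fixes n d :: nat
    and p :: "'l::finite \<Rightarrow> real_mpoly"
    and q :: "'u::finite \<Rightarrow> real_mpoly"
    and x s w :: "real^'u"
    and S :: "real^'l^'l"
  assumes p: "basis_family p (polys n d)"
    and q: "basis_family q (polys n (2 * d))"
    and x: "x \<in> interior (dual_cone (sos_cone n d q))"
    and s: "s \<in> interior (sos_cone n d q)"
    and w: "w = matrix_inv (hessian (barrier p q) x) *v s"
    and S: "S = matrix_inv (Lam p q x) ** Lam p q w ** matrix_inv (Lam p q x)"
  shows "Lam_adj p q S = s \<and>
    ((\<exists>\<delta>>0. norm (psd_sqrt (matrix_inv (hessian (barrier p q) x))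
                 *v (s + \<delta> *\<^sub>R gradient (barrier p q) x)) < \<delta>)
      \<longrightarrow> pos_def S)"
proof -
  interpret gram_bases n d p q
    using p q by unfold_locales
  let ?H = "hessian (barrier p q) x" and ?M = "Lam p q x" and ?N = "matrix_inv (Lam p q x)"
  define C where "C = psd_sqrt ?N"
  note M = Lam_pos_def[OF x] and H = hessian_barrier_pos_def[OF x s]
  note Hmult = hessian_barrier_mult[OF x]
  note Minv = matrix_inv_mult[OF pos_def_invertible[OF M]]
  note Hinv = matrix_inv_mult[OF pos_def_invertible[OF H]]
  have C: "transpose C = C" "C ** C = ?N"
    using psd_sqrt_matrix_inv[OF M] by (simp_all add: C_def)
  have Hw: "?H *v w = s"
    by (simp add: w matrix_vector_mul_assoc Hinv)
  then have adj: "Lam_adj p q S = s"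
    by (simp add: Hmult S)
  have "pos_def S" if "0 < \<delta>"
    and lt: "norm (psd_sqrt (matrix_inv ?H) *v (s + \<delta> *\<^sub>R gradient (barrier p q) x)) < \<delta>" for \<delta>
  proof -
    define u where "u = w - \<delta> *\<^sub>R x"
    let ?g = "gradient (barrier p q) x" and ?X = "C ** Lam p q u ** C"
    \<comment> \<open>In direction \<open>x\<close> the Hessian formula contains
      \<open>?N ** ?M ** ?N = ?N\<close>, the matrix in the gradient formula.\<close>
    have "?H *v x = - ?g"
      by (simp add: Hmult gradient_barrier[OF M] Minv)
    then have Hu: "?H *v u = s + \<delta> *\<^sub>R ?g"
      by (simp add: u_def matrix_vector_mult_diff_distrib matrix_vector_mult_scaleR Hw)
    have "(norm (psd_sqrt (matrix_inv ?H) *v (?H *v u)))\<^sup>2 = (?H *v u) \<bullet> (matrix_inv ?H *v (?H *v u))"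
      by (intro norm_psd_sqrt_mult pos_def_imp_pos_semidef pos_def_matrix_inv H)
    also have "\<dots> = u \<bullet> (?H *v u)"
      by (simp add: matrix_vector_mul_assoc Hinv inner_commute)
    also have "\<dots> = ?X \<bullet> ?X"
      by (simp add: Hmult inner_Lam_adj C(2)[symmetric] inner_congruence[OF C(1)])
    finally have "norm (psd_sqrt (matrix_inv ?H) *v (?H *v u)) = norm ?X"
      by (simp add: power2_norm_eq_inner[symmetric])
    with lt have X: "norm ?X < \<delta>" by (simp add: Hu)
    \<comment> \<open>A right inverse of a square matrix is also a left inverse, which brings
      \<open>?M\<close> between the two factors \<open>C\<close>.\<close>
    have "C ** (C ** ?M) = mat 1"
      by (simp add: matrix_mul_assoc C(2) Minv)
    then have CMC: "C ** ?M ** C = mat 1"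
      by (simp add: matrix_left_right_inverse)
    have "Lam p q w = Lam p q u + \<delta> *\<^sub>R ?M"
      by (simp add: u_def linear_diff[OF linear_Lam] linear_cmul[OF linear_Lam])
    then have CwC: "C ** Lam p q w ** C = ?X + \<delta> *\<^sub>R mat 1"
      by (simp add: matrix_mult.add_left matrix_mult.add_right matrix_mult.scaleR_left
          matrix_mult.scaleR_right CMC)
    show "pos_def S"
      unfolding pos_def_def
    proof (intro conjI allI impI)
      have "transpose ?N = ?N"
        using pos_def_matrix_inv[OF M] by (simp add: pos_def_def)
      then show "transpose S = S"
        by (simp add: S matrix_transpose_mul transpose_Lam matrix_mul_assoc)
      fix v :: "real^'l" assume "v \<noteq> 0"
      define b where "b = C *v v"
      \<comment> \<open>Recovers \<open>v\<close> from \<open>b\<close>, so \<open>b\<close> is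
        nonzero.\<close>
      have "?M *v (C *v b) = v"
        by (simp add: b_def matrix_vector_mul_assoc matrix_mul_assoc[symmetric] C(2) Minv)
      then have "b \<noteq> 0" using \<open>v \<noteq> 0\<close> by auto
      have "S = C ** (C ** Lam p q w ** C) ** C"
        by (simp add: S C(2)[symmetric] matrix_mul_assoc)
      then have "v \<bullet> (S *v v) = b \<bullet> ((C ** Lam p q w ** C) *v b)"
        unfolding b_def
        by (metis C(1) inner_matrix_vector_transpose matrix_vector_mul_assoc)
      also have "\<dots> = b \<bullet> (?X *v b) + \<delta> * (norm b)\<^sup>2"
        by (simp add: CwC matrix_vector_mult_add_rdistrib scaleR_matrix_vector_assoc[symmetric]
            inner_add_right dot_square_norm)
      \<comment> \<open>The perturbation \<open>?X\<close> lowers the form of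
        \<open>\<delta> *\<^sub>R mat 1\<close> at \<open>b\<close> by at most
        \<open>norm ?X * (norm b)\<^sup>2\<close>.\<close>
      finally have "(\<delta> - norm ?X) * (norm b)\<^sup>2 \<le> v \<bullet> (S *v v)"
        using abs_quadratic_form_le[of b ?X] by (simp add: left_diff_distrib)
      moreover have "0 < (\<delta> - norm ?X) * (norm b)\<^sup>2"
        using X \<open>b \<noteq> 0\<close> by simp
      ultimately show "0 < v \<bullet> (S *v v)" by linarith
    qed
  qed
  with adj show ?thesis by blast
qed

end
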